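(* Let $G=(V,E,\mathbf{w},\boldsymbol{\mu})$ be a weighted hypergraph with monotone submodular cut functions $\delta_h(S)=\min\{F_h(S),F_h(h\setminus S)\}$, $h\in E$. Then the vector program RC-Metric below is, up to a constant factor, a relaxation of the minimum ratio-cut problem: there is an absolute constant $C>0$ such that for every $S\subseteq V$ with $\boldsymbol{\mu}(S),\boldsymbol{\mu}(\bar S)>0$ there is a feasible solution of RC-Metric with objective value at most $C\cdot\Psi_G(S)$; in particular the optimum of RC-Metric is at most $C\cdot\Psi_G^*$.
   Context: Each $F_h:2^h\to\mathbb{R}$ is non-decreasing submodular with $F_h(\emptyset)=0$, $F_h(\{i\})>0$; $\|\mathbf{x}\|_{F_h}=\bar F_h(|\mathbf{x}|)$ with $\bar F_h$ the Lovász extension. $\Psi_G(S)=\frac{\sum_hw_h\delta_h(S\cap h)}{\min\{\boldsymbol{\mu}(S),\boldsymbol{\mu}(\bar S)\}}$, $\Psi_G^*=\min_S\Psi_G(S)$, $n=|V|$. The factor graph of $G$ is the bipartite graph on $V\cup E$ with edge $\{i,h\}$ iff $i\in h$. RC-Metric: variables $\mathbf{v}_i\in\mathbb{R}^n$ ($i\in V$) and $\boldsymbol{\ell}^h\in\mathbb{R}^h$ ($h\in E$); minimize $\sum_{h\in E}w_h\|\boldsymbol{\ell}^h\|_{F_h}$ subject to (a) $\sum_{\{i,j\}\subseteq V}\frac{\mu_i\mu_j}{\boldsymbol{\mu}(V)}\|\mathbf{v}_i-\mathbf{v}_j\|_2^2\ge1$; (b) for every pair $\{i,j\}$ and every path $i=u_0,h_1,u_1,h_2,\dots,h_k,u_k=j$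 in the factor graph, $\|\mathbf{v}_i-\mathbf{v}_j\|_2^2\le\sum_{m=1}^k(\ell^{h_m}_{u_{m-1}}+\ell^{h_m}_{u_m})$; (c) $\|\mathbf{v}_i-\mathbf{v}_j\|_2^2\le\|\mathbf{v}_i-\mathbf{v}_k\|_2^2+\|\mathbf{v}_k-\mathbf{v}_j\|_2^2$ for all $i,j,k\in V$. *)

theory Defs
  imports "HOL-Analysis.Analysis"
begin

text \<open>
  Hypergraphs with a finite vertex set inside an arbitrary (possibly infinite) type, rather than
  a type of class \<open>finite\<close>: a constant that is chosen before the hypergraph is then
  uniform in the number of vertices.  The function \<open>F\<^sub>h\<close> is
  \<open>cut_fun G h\<close>; only its values on subsets of \<open>h\<close> are ever used.
\<close>

record 'v hypergraph =
  verts :: "'v set"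
  hedges :: "'v set set"
  weight :: "'v set \<Rightarrow> real"
  mass :: "'v \<Rightarrow> real"
  cut_fun :: "'v set \<Rightarrow> 'v set \<Rightarrow> real"

definition submodular_on :: "'v set \<Rightarrow> ('v set \<Rightarrow> real) \<Rightarrow> bool" where
  "submodular_on h F \<longleftrightarrow>
     (\<forall>A B. A \<subseteq> h \<longrightarrow> B \<subseteq> h \<longrightarrow> F (A \<union> B) + F (A \<inter> B) \<le> F A + F B)"

definition monotone_submodular_hypergraph :: "'v hypergraph \<Rightarrow> bool" where
  "monotone_submodular_hypergraph G \<longleftrightarrow>
     finite (verts G) \<and>
     hedges G \<subseteq> Pow (verts G) \<and>
     (\<forall>h\<in>hedges G. 0 \<le> weight G h) \<and>
     (\<forall>i\<in>verts G. 0 \<le> mass G i) \<and>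
     (\<forall>h\<in>hedges G.
        mono_on (Pow h) (cut_fun G h) \<and>
        submodular_on h (cut_fun G h) \<and>
        cut_fun G h {} = 0 \<and>
        (\<forall>i\<in>h. 0 < cut_fun G h {i}))"

definition split_cost :: "'v hypergraph \<Rightarrow> 'v set \<Rightarrow> 'v set \<Rightarrow> real" where
  "split_cost G h S = min (cut_fun G h S) (cut_fun G h (h - S))"

definition total_mass :: "'v hypergraph \<Rightarrow> 'v set \<Rightarrow> real" where
  "total_mass G S = (\<Sum>i\<in>S. mass G i)"

definition proper_cut :: "'v hypergraph \<Rightarrow> 'v set \<Rightarrow> bool" where
  "proper_cut G S \<longleftrightarrow>
     S \<subseteq> verts G \<and> 0 < total_mass G S \<and> 0 < total_mass G (verts G - S)"

definition ratio_cut :: "'v hypergraph \<Rightarrow> 'v set \<Rightarrow> real" where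
  "ratio_cut G S =
     (\<Sum>h\<in>hedges G. weight G h * split_cost G h (S \<inter> h)) /
     min (total_mass G S) (total_mass G (verts G - S))"

text \<open>The ratio is only meaningful for cuts with positive mass on both sides.\<close>

definition min_ratio_cut :: "'v hypergraph \<Rightarrow> real" where
  "min_ratio_cut G = Min (ratio_cut G ` {S. proper_cut G S})"

text \<open>
  The Lovasz extension: list the elements of \<open>h\<close> by non-increasing value of \<open>x\<close>
  and weight the increments of \<open>F\<close> along the resulting chain of sets.  The value does
  not depend on how ties are broken.
\<close>

definition lovasz_extension :: "'v set \<Rightarrow> ('v set \<Rightarrow> real) \<Rightarrow> ('v \<Rightarrow> real) \<Rightarrow> real" where
  "lovasz_extension h F x =
     (let us = (SOME us. distinct us \<and> set us = h \<and> sorted_wrt (\<lambda>i j. x j \<le> x i) us)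
      in \<Sum>k<length us. x (us ! k) * (F (set (take (Suc k) us)) - F (set (take k us))))"

definition hnorm :: "'v set \<Rightarrow> ('v set \<Rightarrow> real) \<Rightarrow> ('v \<Rightarrow> real) \<Rightarrow> real" where
  "hnorm h F x = lovasz_extension h F (\<lambda>i. \<bar>x i\<bar>)"

text \<open>
  A path in the bipartite factor graph between two vertices \<open>i\<close> and \<open>j\<close>
  alternates between vertices \<open>us\<close> and hyperedges \<open>hs\<close>; being a path, it
  repeats neither.
\<close>

definition factor_edge :: "'v hypergraph \<Rightarrow> 'v \<Rightarrow> 'v set \<Rightarrow> bool" where
  "factor_edge G i h \<longleftrightarrow> i \<in> verts G \<and> h \<in> hedges G \<and> i \<in> h"

definition factor_path :: "'v hypergraph \<Rightarrow> 'v \<Rightarrow> 'v list \<Rightarrow> 'v set list \<Rightarrow> 'v \<Rightarrow> bool" where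
  "factor_path G i us hs j \<longleftrightarrow>
     length us = Suc (length hs) \<and> hd us = i \<and> last us = j \<and>
     distinct us \<and> distinct hs \<and>
     (\<forall>m<length hs. factor_edge G (us ! m) (hs ! m) \<and> factor_edge G (us ! Suc m) (hs ! m))"

text \<open>
  A vector of dimension \<open>n\<close> is a function on \<open>nat\<close> of which only the
  coordinates below \<open>n\<close> count.
\<close>

definition sqdist :: "nat \<Rightarrow> (nat \<Rightarrow> real) \<Rightarrow> (nat \<Rightarrow> real) \<Rightarrow> real" where
  "sqdist n x y = (L2_set (\<lambda>k. x k - y k) {..<n})\<^sup>2"

text \<open>
  The variables are \<open>v i\<close> for vertices \<open>i\<close>, of dimension the number of
  vertices, and \<open>l h\<close> for hyperedges \<open>h\<close>, of which only the values on
  \<open>h\<close> are used.  The sum over unordered pairs in the first constraint is half of the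
  sum over ordered pairs.
\<close>

definition rc_feasible ::
  "'v hypergraph \<Rightarrow> ('v \<Rightarrow> nat \<Rightarrow> real) \<Rightarrow> ('v set \<Rightarrow> 'v \<Rightarrow> real) \<Rightarrow> bool" where
  "rc_feasible G v l \<longleftrightarrow>
     (let n = card (verts G) in
       1 \<le> (\<Sum>i\<in>verts G. \<Sum>j\<in>verts G - {i}.
              mass G i * mass G j / total_mass G (verts G) * sqdist n (v i) (v j)) / 2 \<and>
       (\<forall>i\<in>verts G. \<forall>j\<in>verts G. i \<noteq> j \<longrightarrow>
          (\<forall>us hs. factor_path G i us hs j \<longrightarrow>
             sqdist n (v i) (v j)
               \<le> (\<Sum>m<length hs. l (hs ! m) (us ! m) + l (hs ! m) (us ! Suc m)))) \<and>
       (\<forall>i\<in>verts G. \<forall>j\<in>verts G. \<forall>k\<in>verts G.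
          sqdist n (v i) (v j) \<le> sqdist n (v i) (v k) + sqdist n (v k) (v j)))"

definition rc_objective :: "'v hypergraph \<Rightarrow> ('v set \<Rightarrow> 'v \<Rightarrow> real) \<Rightarrow> real" where
  "rc_objective G l = (\<Sum>h\<in>hedges G. weight G h * hnorm h (cut_fun G h) (l h))"

definition rc_optimum :: "'v hypergraph \<Rightarrow> ereal" where
  "rc_optimum G = (INF (v, l)\<in>{(v, l). rc_feasible G v l}. ereal (rc_objective G l))"

end

theory Submission
  imports Defs
begin

text \<open>
  Put \<open>a = \<mu>(V) / (\<mu>(S) \<mu>(V - S))\<close>, so that \<open>a \<le> 2 / min (\<mu>(S)) (\<mu>(V - S))\<close>.  Embed
  the vertices on a line, with \<open>S\<close> at \<open>sqrt a\<close> and its complement at \<open>0\<close>, and let \<open>l h\<close>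
  be \<open>a\<close> times the indicator of the cheaper of the two sides of \<open>h\<close>.  The value of \<open>a\<close>
  makes the spreading constraint an equality.  A path that joins the two sides contains a
  hyperedge with an end point on each side, one of which carries the length \<open>a\<close>.  The
  Lovasz extension is \<open>a F(T)\<close> at \<open>a\<close> times the indicator of \<open>T\<close>, so the objective is
  \<open>a\<close> times the weight of the cut.
\<close>

text \<open>Sorting lists the elements of \<open>T\<close> first, so the increments carry the factor
  \<open>a\<close> while the chain grows inside \<open>T\<close> and the factor 0 afterwards; the
  first part telescopes from \<open>F {} = 0\<close>.\<close>

lemma chain_sum_indicator:
  fixes F :: "'v set \<Rightarrow> real"
  assumes "sorted_wrt (\<lambda>i j. x j \<le> x i) us" and "0 < a" and "F {} = 0"
    and x: "x = (\<lambda>i. if i \<in> T then a else 0)"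
  shows "(\<Sum>k<length us. x (us ! k) * (F (set (take (Suc k) us)) - F (set (take k us))))
    = a * F (set us \<inter> T)"
  using assms(1)
proof (induction us rule: rev_induct)
  case Nil
  then show ?case using assms by simp
next
  case (snoc y us)
  have IH: "(\<Sum>k<length us. x (us ! k) * (F (set (take (Suc k) us)) - F (set (take k us))))
      = a * F (set us \<inter> T)"
    using snoc by (simp add: sorted_wrt_append)
  have "(\<Sum>k<length (us @ [y]). x ((us @ [y]) ! k) *
        (F (set (take (Suc k) (us @ [y]))) - F (set (take k (us @ [y])))))
      = a * F (set us \<inter> T) + x y * (F (insert y (set us)) - F (set us))"
    using IH by (simp add: nth_append)
  also have "\<dots> = a * F (set (us @ [y]) \<inter> T)"
  proof (cases "y \<in> T")
    case True
    \<comment> \<open>The last entry has the smallest value, so if that value is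
      \<open>a > 0\<close>, no earlier entry can have value 0.\<close>
    then have "set us \<subseteq> T"
      using snoc.prems \<open>0 < a\<close> unfolding x
      by (auto simp: sorted_wrt_append split: if_splits)
    then have "set us \<inter> T = set us" "set (us @ [y]) \<inter> T = insert y (set us)"
      using True by auto
    then show ?thesis
      using True by (simp add: x algebra_simps)
  qed (simp add: x)
  finally show ?case .
qed

text \<open>The chain sum is the same for every sorted enumeration, so nothing about the one picked
  by \<open>SOME\<close> matters beyond its existence.\<close>

lemma hnorm_scaled_indicator:
  assumes "finite h" "T \<subseteq> h" "0 < a" "F {} = 0"
  shows "hnorm h F (\<lambda>i. if i \<in> T then a else 0) = a * F T"
proof -
  define x where "x = (\<lambda>i. if i \<in> T then a else 0)"
  define P where "P us \<longleftrightarrow> distinct us \<and> set us = h \<and> sorted_wrt (\<lambda>i j. x j \<le> x i) us" for us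
  obtain ws where ws: "set ws = h" "distinct ws"
    using finite_distinct_list[OF \<open>finite h\<close>] by blast
  \<comment> \<open>\<open>sort_key\<close> sorts upwards; negating the key gives the non-increasing
    order of \<open>x\<close>.\<close>
  have "sorted (map (\<lambda>i. - x i) (sort_key (\<lambda>i. - x i) ws))"
    by (rule sorted_sort_key)
  then have "P (sort_key (\<lambda>i. - x i) ws)"
    using ws unfolding P_def sorted_map by simp
  then have "P (SOME us. P us)"
    by (rule someI)
  then have P: "set (SOME us. P us) = h" "sorted_wrt (\<lambda>i j. x j \<le> x i) (SOME us. P us)"
    by (simp_all only: P_def[of "SOME us. P us"])
  have abs_x: "(\<lambda>i. \<bar>x i\<bar>) = x"
    using \<open>0 < a\<close> by (auto simp: x_def)
  have "hnorm h F x = a * F (set (SOME us. P us) \<inter> T)"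
    unfolding hnorm_def abs_x lovasz_extension_def Let_def P_def[symmetric]
    by (rule chain_sum_indicator[of x _ a F T, OF P(2) assms(3,4) x_def])
  also have "\<dots> = a * F T"
    using P(1) \<open>T \<subseteq> h\<close> by (simp add: Int_absorb1)
  finally show ?thesis
    by (simp add: x_def)
qed

lemma sqdist_scaled_indicator:
  assumes "0 < n" "0 \<le> a"
  shows "sqdist n (\<lambda>k. if k = 0 \<and> i \<in> S then sqrt a else 0)
      (\<lambda>k. if k = 0 \<and> j \<in> S then sqrt a else 0) = (if i \<in> S \<longleftrightarrow> j \<in> S then 0 else a)"
proof -
  have "(\<Sum>k<n. ((if k = 0 \<and> i \<in> S then sqrt a else 0) - (if k = 0 \<and> j \<in> S then sqrt a else 0))\<^sup>2)
     = (\<Sum>k<n. if k = 0 then (if i \<in> S \<longleftrightarrow> j \<in> S then 0 else a) else 0)"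
    using assms by (intro sum.cong) auto
  also have "\<dots> = (if i \<in> S \<longleftrightarrow> j \<in> S then 0 else a)"
    using assms by simp
  finally show ?thesis
    using assms by (simp add: sqdist_def L2_set_def)
qed

text \<open>A discrete intermediate value argument: membership in \<open>S\<close> that never
  changes between neighbours is constant along the list. It locates the hyperedge at which a path
  crosses the cut.\<close>

lemma consecutive_separated:
  assumes "us \<noteq> []" "\<not> (hd us \<in> S \<longleftrightarrow> last us \<in> S)"
  shows "\<exists>m. Suc m < length us \<and> \<not> (us ! m \<in> S \<longleftrightarrow> us ! Suc m \<in> S)"
proof (rule ccontr)
  assume "\<not> ?thesis"
  then have step: "us ! Suc m \<in> S \<longleftrightarrow> us ! m \<in> S" if "Suc m < length us" for m
    using that by blast
  have "m < length us \<Longrightarrow> us ! m \<in> S \<longleftrightarrow> us ! 0 \<in> S" for m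
    by (induction m) (simp_all add: step)
  from this[of "length us - 1"] show False
    using assms by (simp add: hd_conv_nth last_conv_nth)
qed

lemma total_mass_split:
  assumes "finite (verts G)" "S \<subseteq> verts G"
  shows "total_mass G (verts G) = total_mass G S + total_mass G (verts G - S)"
  using sum.subset_diff[OF assms(2,1)] by (simp add: total_mass_def add.commute)

text \<open>Only pairs with one element on each side contribute; the factor 2 arises because each
  such pair occurs in both orders.\<close>

lemma sum_separated_pairs:
  fixes c :: real
  assumes "finite (verts G)" "S \<subseteq> verts G"
  shows "(\<Sum>i\<in>verts G. \<Sum>j\<in>verts G - {i}.
      mass G i * mass G j / d * (if i \<in> S \<longleftrightarrow> j \<in> S then 0 else c))
    = 2 * (total_mass G S * total_mass G (verts G - S) / d * c)"
proof -
  let ?V = "verts G" and ?R = "verts G - S"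
  let ?f = "\<lambda>i j. mass G i * mass G j / d * (if i \<in> S \<longleftrightarrow> j \<in> S then 0 else c)"
  have split: "sum g ?V = sum g S + sum g ?R" for g :: "'a \<Rightarrow> real"
    using sum.subset_diff[OF assms(2,1)] by (simp add: add.commute)
  have prod: "(\<Sum>i\<in>A. \<Sum>j\<in>B. mass G i * mass G j / d * c)
      = total_mass G A * total_mass G B / d * c" for A B
    unfolding total_mass_def sum_product by (simp add: sum_distrib_right sum_divide_distrib)
  \<comment> \<open>The diagonal may be added, since a vertex is never separated from
    itself.\<close>
  have "(\<Sum>i\<in>?V. \<Sum>j\<in>?V - {i}. ?f i j) = (\<Sum>i\<in>?V. \<Sum>j\<in>?V. ?f i j)"
    by (rule sum.cong[OF refl]) (simp add: sum_diff1 assms(1))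
  also have "\<dots> = (\<Sum>i\<in>S. \<Sum>j\<in>?R. mass G i * mass G j / d * c)
      + (\<Sum>i\<in>?R. \<Sum>j\<in>S. mass G i * mass G j / d * c)"
    unfolding split by simp
  finally show ?thesis
    unfolding prod by (simp add: mult.commute)
qed

lemma proper_cut_solution:
  assumes G: "monotone_submodular_hypergraph G" and S: "proper_cut G S"
  shows "\<exists>v l. rc_feasible G v l \<and> rc_objective G l \<le> 2 * ratio_cut G S"
proof -
  define s t where "s = total_mass G S" and "t = total_mass G (verts G - S)"
  define a where "a = total_mass G (verts G) / (s * t)"
  define T where "T h = (if cut_fun G h (S \<inter> h) \<le> cut_fun G h (h - S) then S \<inter> h else h - S)" for h
  define v where "v i k = (if k = 0 \<and> i \<in> S then sqrt a else 0)" for i and k :: nat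
  define l where "l h i = (if i \<in> T h then a else 0)" for h i
  have fin: "finite (verts G)" and sub: "S \<subseteq> verts G" and st: "0 < s" "0 < t"
    using G S by (auto simp: monotone_submodular_hypergraph_def proper_cut_def s_def t_def)
  have mass: "total_mass G (verts G) = s + t"
    using total_mass_split[OF fin sub] by (simp add: s_def t_def)
  have a: "0 < a" "s * t / total_mass G (verts G) * a = 1"
    using st by (auto simp: a_def mass)
  \<comment> \<open>The constant 2 of the theorem counts these two summands, each at most
    \<open>1 / min s t\<close>.\<close>
  have "a = 1 / t + 1 / s"
    using st by (simp add: a_def mass field_simps)
  also have "\<dots> \<le> 1 / min s t + 1 / min s t"
    using st by (intro add_mono divide_left_mono) (auto simp: min_def)
  finally have a_le: "a \<le> 2 / min s t"
    by simp
  \<comment> \<open>This makes the dimension positive, so that coordinate 0, which carries the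
    embedding, counts.\<close>
  have "verts G \<noteq> {}"
    using sub st(1) by (auto simp: s_def total_mass_def)
  then have dist: "sqdist (card (verts G)) (v i) (v j) = (if i \<in> S \<longleftrightarrow> j \<in> S then 0 else a)" for i j
    unfolding v_def using fin a by (intro sqdist_scaled_indicator) (auto simp: card_gt_0_iff)
  have l_nonneg: "0 \<le> l h i" for h i
    using a by (simp add: l_def)
  have path: "sqdist (card (verts G)) (v i) (v j)
      \<le> (\<Sum>m<length hs. l (hs ! m) (us ! m) + l (hs ! m) (us ! Suc m))"
    if p: "factor_path G i us hs j" for i j us hs
  proof (cases "i \<in> S \<longleftrightarrow> j \<in> S")
    case True
    then show ?thesis
      using l_nonneg by (simp add: dist sum_nonneg)
  next
    case False
    moreover have "us \<noteq> []" "hd us = i" "last us = j" "length us = Suc (length hs)"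
      using p by (auto simp: factor_path_def)
    ultimately obtain m where m: "m < length hs" "\<not> (us ! m \<in> S \<longleftrightarrow> us ! Suc m \<in> S)"
      using consecutive_separated[of us S] by auto
    then have "us ! m \<in> hs ! m" "us ! Suc m \<in> hs ! m"
      using p by (auto simp: factor_path_def factor_edge_def)
    \<comment> \<open>Whichever side of the hyperedge \<open>T\<close> selects, it contains exactly
      one of these two end points.\<close>
    then have "a \<le> l (hs ! m) (us ! m) + l (hs ! m) (us ! Suc m)"
      using m(2) a by (auto simp: l_def T_def)
    also have "\<dots> \<le> (\<Sum>m<length hs. l (hs ! m) (us ! m) + l (hs ! m) (us ! Suc m))"
      using m(1) l_nonneg
      by (intro member_le_sum[where f = "\<lambda>m. l (hs ! m) (us ! m) + l (hs ! m) (us ! Suc m)"]) auto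
    finally show ?thesis
      using False by (simp add: dist)
  qed
  have "rc_feasible G v l"
    unfolding rc_feasible_def Let_def
  proof (intro conjI)
    show "1 \<le> (\<Sum>i\<in>verts G. \<Sum>j\<in>verts G - {i}. mass G i * mass G j / total_mass G (verts G) *
        sqdist (card (verts G)) (v i) (v j)) / 2"
      unfolding dist sum_separated_pairs[OF fin sub] a(2)[unfolded s_def t_def] by simp
  \<comment> \<open>For the triangle inequality: if \<open>i\<close> and \<open>j\<close> are
    separated, any \<open>k\<close> is separated from one of them.\<close>
  qed (use path a in \<open>auto simp: dist\<close>)
  moreover have "rc_objective G l \<le> 2 * ratio_cut G S"
  proof -
    have edge: "hnorm h (cut_fun G h) (l h) = a * split_cost G h (S \<inter> h)"
        "0 \<le> weight G h * split_cost G h (S \<inter> h)" if h: "h \<in> hedges G" for h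
    proof -
      have F: "h \<subseteq> verts G" "cut_fun G h {} = 0" "0 \<le> weight G h" "mono_on (Pow h) (cut_fun G h)"
        using G h by (auto simp: monotone_submodular_hypergraph_def)
      have diff: "h - S \<inter> h = h - S"
        by blast
      have "hnorm h (cut_fun G h) (l h) = a * cut_fun G h (T h)"
        unfolding l_def using F a finite_subset[OF F(1) fin] by (intro hnorm_scaled_indicator) (auto simp: T_def)
      then show "hnorm h (cut_fun G h) (l h) = a * split_cost G h (S \<inter> h)"
        by (simp add: T_def split_cost_def min_def diff)
      \<comment> \<open>Nonnegative cut costs are what allows \<open>a\<close> to be replaced by its
        upper bound in the objective.\<close>
      have "0 \<le> cut_fun G h A" if "A \<subseteq> h" for A
        using mono_onD[OF F(4), of "{}" A] that F(2) by simp
      then show "0 \<le> weight G h * split_cost G h (S \<inter> h)"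
        using F(3) by (simp add: split_cost_def diff)
    qed
    have "rc_objective G l = a * (\<Sum>h\<in>hedges G. weight G h * split_cost G h (S \<inter> h))"
      unfolding rc_objective_def sum_distrib_left
      by (intro sum.cong refl) (simp add: edge mult_ac)
    also have "\<dots> \<le> 2 / min s t * (\<Sum>h\<in>hedges G. weight G h * split_cost G h (S \<inter> h))"
      using a_le edge(2) by (intro mult_right_mono sum_nonneg)
    finally show ?thesis
      by (simp add: ratio_cut_def s_def t_def)
  qed
  ultimately show ?thesis
    by blast
qed

text \<open>There are finitely many cuts; a proper one must exist because \<open>Min\<close> of the
  empty set is unspecified. The bound on the optimum then follows from a minimizing cut.\<close>

lemma min_ratio_cut_attained:
  assumes "monotone_submodular_hypergraph G" "\<exists>S. proper_cut G S"
  shows "\<exists>S. proper_cut G S \<and> ratio_cut G S = min_ratio_cut G"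
proof -
  have "finite {S. proper_cut G S}"
    by (rule finite_subset[of _ "Pow (verts G)"])
      (use assms(1) in \<open>auto simp: proper_cut_def monotone_submodular_hypergraph_def\<close>)
  then have "min_ratio_cut G \<in> ratio_cut G ` {S. proper_cut G S}"
    unfolding min_ratio_cut_def using assms(2) by (intro Min_in) auto
  then show ?thesis
    by auto
qed

lemma rc_optimum_le_objective:
  "rc_feasible G v l \<Longrightarrow> rc_optimum G \<le> ereal (rc_objective G l)"
  unfolding rc_optimum_def by (rule INF_lower2[of "(v, l)"]) auto

theorem mainTheorem8:
  shows "\<exists>C::real. C > 0 \<and>
    (\<forall>G :: 'v hypergraph. monotone_submodular_hypergraph G \<longrightarrow>
       (\<forall>S. proper_cut G S \<longrightarrow>
          (\<exists>v l. rc_feasible G v l \<and> rc_objective G l \<le> C * ratio_cut G S)) \<and>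
       ((\<exists>S. proper_cut G S) \<longrightarrow> rc_optimum G \<le> ereal (C * min_ratio_cut G)))"
proof (intro exI[of _ 2] conjI allI impI)
  fix G :: "'v hypergraph"
  assume G: "monotone_submodular_hypergraph G"
  show "\<exists>v l. rc_feasible G v l \<and> rc_objective G l \<le> 2 * ratio_cut G S" if "proper_cut G S" for S
    using proper_cut_solution[OF G that] .
  assume "\<exists>S. proper_cut G S"
  then obtain S where "proper_cut G S" and min: "ratio_cut G S = min_ratio_cut G"
    using min_ratio_cut_attained[OF G] by blast
  then obtain v l where "rc_feasible G v l" "rc_objective G l \<le> 2 * min_ratio_cut G"
    using proper_cut_solution[OF G, of S] by auto
  then show "rc_optimum G \<le> ereal (2 * min_ratio_cut G)"
    using rc_optimum_le_objective order_trans ereal_less_eq(3) by metis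
qed simp

end
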